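(* Let $I=(0,1)$, $g>0$, and let $a\neq0$ and $b>0$ be real numbers such that $$b\tanh b>1,\qquad |a|<\sqrt{1-(b\tanh b)^{-1}}.$$ Let $H(\lambda)=g^{-1}$ and $\tilde u(\lambda)=a\tanh(b(2\lambda-1))$ for $\lambda\in I$. Then the spectrum of the bounded operator $A_0:L^2(I)^2\to L^2(I)^2$, $$A_0\begin{pmatrix}\phi_1\\ \phi_2\end{pmatrix}=\begin{pmatrix}\tilde u\,\phi_1+H\phi_2\\ g\int_0^1\phi_1\,\mathrm{d}\lambda+\tilde u\,\phi_2\end{pmatrix},$$ has at least two complex conjugate eigenvalues $c$ with $\mathrm{Re}\,c=0$ and $\mathrm{Im}\,c\neq0$.
   Context: $L^2(I)$ is the space of complex-valued square integrable functions on $I$; $g$ is the gravity constant. *)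

theory Defs
  imports "HOL-Analysis.Analysis"
begin

section \<open>Complex normed spaces, eigenvalues and spectrum\<close>

class scaleC =
  fixes scaleC :: "complex \<Rightarrow> 'a \<Rightarrow> 'a" (infixr \<open>*\<^sub>C\<close> 75)

class complex_normed_vector = real_normed_vector + scaleC +
  assumes scaleC_add_right: "c *\<^sub>C (x + y) = c *\<^sub>C x + c *\<^sub>C y"
    and scaleC_add_left: "(c + d) *\<^sub>C x = c *\<^sub>C x + d *\<^sub>C x"
    and scaleC_scaleC: "c *\<^sub>C (d *\<^sub>C x) = (c * d) *\<^sub>C x"
    and scaleC_one: "1 *\<^sub>C x = x"
    and scaleR_scaleC: "r *\<^sub>R x = complex_of_real r *\<^sub>C x"
    and norm_scaleC: "norm (c *\<^sub>C x) = cmod c * norm x"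

definition bounded_clinear ::
    "('a::complex_normed_vector \<Rightarrow> 'b::complex_normed_vector) \<Rightarrow> bool" where
  "bounded_clinear T \<longleftrightarrow> bounded_linear T \<and> (\<forall>c x. T (c *\<^sub>C x) = c *\<^sub>C T x)"

definition eigenvalue :: "('a::complex_normed_vector \<Rightarrow> 'a) \<Rightarrow> complex \<Rightarrow> bool" where
  "eigenvalue T c \<longleftrightarrow> (\<exists>v. v \<noteq> 0 \<and> T v = c *\<^sub>C v)"

definition spectrum :: "('a::complex_normed_vector \<Rightarrow> 'a) \<Rightarrow> complex set" where
  "spectrum T = {c. \<not> (\<exists>S. bounded_clinear S \<and>
      (\<forall>v. S (T v - c *\<^sub>C v) = v) \<and> (\<forall>v. T (S v) - c *\<^sub>C S v = v))}"

instantiation prod :: (complex_normed_vector, complex_normed_vector) complex_normed_vector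
begin

definition scaleC_prod_def: "c *\<^sub>C p = (c *\<^sub>C fst p, c *\<^sub>C snd p)"

instance
proof
  fix c d :: complex and r :: real and x y :: "'a \<times> 'b"
  show "c *\<^sub>C (x + y) = c *\<^sub>C x + c *\<^sub>C y"
    by (simp add: scaleC_prod_def scaleC_add_right)
  show "(c + d) *\<^sub>C x = c *\<^sub>C x + d *\<^sub>C x"
    by (simp add: scaleC_prod_def scaleC_add_left)
  show "c *\<^sub>C (d *\<^sub>C x) = (c * d) *\<^sub>C x"
    by (simp add: scaleC_prod_def scaleC_scaleC)
  show "1 *\<^sub>C x = x"
    by (simp add: scaleC_prod_def scaleC_one)
  show "r *\<^sub>R x = complex_of_real r *\<^sub>C x"
    by (simp add: scaleC_prod_def scaleR_prod_def scaleR_scaleC)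
  show "norm (c *\<^sub>C x) = cmod c * norm x"
    by (simp add: scaleC_prod_def norm_prod_def norm_scaleC power_mult_distrib
        flip: distrib_left) (simp add: real_sqrt_mult)
qed

end


section \<open>The space of square integrable functions on the open unit interval\<close>

abbreviation unit_measure :: "real measure" where
  "unit_measure \<equiv> lebesgue_on {0<..<1}"

definition square_integrable :: "(real \<Rightarrow> complex) \<Rightarrow> bool" where
  "square_integrable f \<longleftrightarrow> f \<in> borel_measurable unit_measure \<and>
     integrable unit_measure (\<lambda>x. (cmod (f x))\<^sup>2)"

definition L2_rel :: "(real \<Rightarrow> complex) \<Rightarrow> (real \<Rightarrow> complex) \<Rightarrow> bool" where
  "L2_rel f g \<longleftrightarrow> square_integrable f \<and> square_integrable g \<and> (AE x in unit_measure. f x = g x)"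

lemma finite_unit_measure: "finite_measure unit_measure"
  by (rule finite_measureI) (simp add: emeasure_restrict_space)

lemma square_integrable_measurable [measurable_dest]:
  "square_integrable f \<Longrightarrow> f \<in> borel_measurable unit_measure"
  by (simp add: square_integrable_def)

lemma square_integrable_const: "square_integrable (\<lambda>_. c)"
  using finite_unit_measure by (simp add: square_integrable_def finite_measure.integrable_const)

lemma square_integrable_add:
  assumes f: "square_integrable f" and g: "square_integrable g"
  shows "square_integrable (\<lambda>x. f x + g x)"
proof -
  have [measurable]: "f \<in> borel_measurable unit_measure" "g \<in> borel_measurable unit_measure"
    using f g by (auto simp: square_integrable_def)
  have *: "(cmod (z + w))\<^sup>2 \<le> 2 * (cmod z)\<^sup>2 + 2 * (cmod w)\<^sup>2" for z w
  proof -
    have "(cmod (z + w))\<^sup>2 \<le> (cmod z + cmod w)\<^sup>2"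
      by (intro power_mono norm_triangle_ineq) auto
    also have "\<dots> \<le> 2 * (cmod z)\<^sup>2 + 2 * (cmod w)\<^sup>2"
      using sum_squares_bound[of "cmod z" "cmod w"] by (simp add: power2_sum)
    finally show ?thesis .
  qed
  have "integrable unit_measure (\<lambda>x. (cmod (f x + g x))\<^sup>2)"
  proof (rule Bochner_Integration.integrable_bound)
    show "integrable unit_measure (\<lambda>x. 2 * (cmod (f x))\<^sup>2 + 2 * (cmod (g x))\<^sup>2)"
      using f g by (auto simp: square_integrable_def)
    show "AE x in unit_measure. norm ((cmod (f x + g x))\<^sup>2)
        \<le> norm (2 * (cmod (f x))\<^sup>2 + 2 * (cmod (g x))\<^sup>2)"
      using * by simp
  qed simp
  then show ?thesis by (simp add: square_integrable_def)
qed

lemma square_integrable_mult_bounded: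
  assumes h: "h \<in> borel_measurable unit_measure" and b: "bounded (h ` {0<..<1})"
    and f: "square_integrable f"
  shows "square_integrable (\<lambda>x. h x * f x)"
proof -
  have [measurable]: "f \<in> borel_measurable unit_measure" "h \<in> borel_measurable unit_measure"
    using f h by (auto simp: square_integrable_def)
  obtain B where B: "\<And>x. x \<in> {0<..<1} \<Longrightarrow> cmod (h x) \<le> B"
    using b unfolding bounded_iff by blast
  have "integrable unit_measure (\<lambda>x. (cmod (h x * f x))\<^sup>2)"
  proof (rule Bochner_Integration.integrable_bound)
    show "integrable unit_measure (\<lambda>x. B\<^sup>2 * (cmod (f x))\<^sup>2)"
      using f by (auto simp: square_integrable_def)
    show "AE x in unit_measure. norm ((cmod (h x * f x))\<^sup>2) \<le> norm (B\<^sup>2 * (cmod (f x))\<^sup>2)"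
    proof (rule AE_I2)
      fix x assume "x \<in> space unit_measure"
      then have "cmod (h x) \<le> B" using B by simp
      then have "(cmod (h x))\<^sup>2 \<le> B\<^sup>2" by (intro power_mono) auto
      then show "norm ((cmod (h x * f x))\<^sup>2) \<le> norm (B\<^sup>2 * (cmod (f x))\<^sup>2)"
        by (simp add: norm_mult power_mult_distrib mult_right_mono)
    qed
  qed simp
  then show ?thesis by (simp add: square_integrable_def)
qed

lemma square_integrable_cmult: "square_integrable f \<Longrightarrow> square_integrable (\<lambda>x. c * f x)"
  by (rule square_integrable_mult_bounded) (auto simp: bounded_iff)

lemma square_integrable_uminus: "square_integrable f \<Longrightarrow> square_integrable (\<lambda>x. - f x)"
  using square_integrable_cmult[of f "-1"] by simp

lemma square_integrable_integrable_mult: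
  assumes f: "square_integrable f" and g: "square_integrable g"
  shows "integrable unit_measure (\<lambda>x. f x * cnj (g x))"
proof (rule Bochner_Integration.integrable_bound)
  show "integrable unit_measure (\<lambda>x. (cmod (f x))\<^sup>2 + (cmod (g x))\<^sup>2)"
    using f g by (auto simp: square_integrable_def)
  have [measurable]: "f \<in> borel_measurable unit_measure" "g \<in> borel_measurable unit_measure"
    using f g by (auto simp: square_integrable_def)
  have [measurable]: "cnj \<in> borel_measurable borel"
    by (intro borel_measurable_continuous_onI continuous_intros)
  show "(\<lambda>x. f x * cnj (g x)) \<in> borel_measurable unit_measure"
    by measurable
  have "cmod z * cmod w \<le> (cmod z)\<^sup>2 + (cmod w)\<^sup>2" for z w
  proof -
    have "0 \<le> cmod z * cmod w" by simp
    moreover have "2 * (cmod z * cmod w) \<le> (cmod z)\<^sup>2 + (cmod w)\<^sup>2"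
      using sum_squares_bound[of "cmod z" "cmod w"] by (simp add: mult.assoc)
    ultimately show ?thesis by linarith
  qed
  then show "AE x in unit_measure. norm (f x * cnj (g x)) \<le> norm ((cmod (f x))\<^sup>2 + (cmod (g x))\<^sup>2)"
    by (simp add: norm_mult)
qed

lemma square_integrable_integrable:
  assumes "square_integrable f"
  shows "integrable unit_measure f"
  using square_integrable_integrable_mult[OF assms square_integrable_const[of 1]] by simp

lemma L2_rel_eqI:
  assumes "square_integrable f" and "\<And>x. f x = g x"
  shows "L2_rel f g"
proof -
  have "f = g" using assms(2) by (rule ext)
  then show ?thesis using assms(1) by (simp add: L2_rel_def)
qed

lemma L2_rel_refl: "L2_rel f f \<longleftrightarrow> square_integrable f"
  by (simp add: L2_rel_def)

lemmas square_integrable_intros = square_integrable_add square_integrable_uminus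
  square_integrable_cmult square_integrable_const

quotient_type L2 = "real \<Rightarrow> complex" / partial: L2_rel
proof (rule part_equivpI)
  show "\<exists>f. L2_rel f f"
    using square_integrable_const by (auto simp: L2_rel_def)
  show "symp L2_rel"
    by (auto simp: symp_def L2_rel_def elim: eventually_mono)
  show "transp L2_rel"
  proof (rule transpI)
    fix f g h assume "L2_rel f g" "L2_rel g h"
    moreover from this have "AE x in unit_measure. f x = g x" "AE x in unit_measure. g x = h x"
      by (simp_all add: L2_rel_def)
    then have "AE x in unit_measure. f x = h x"
      by eventually_elim simp
    ultimately show "L2_rel f h"
      by (simp add: L2_rel_def)
  qed
qed

instantiation L2 :: real_inner
begin

lift_definition zero_L2 :: L2 is "\<lambda>_. 0"
  by (simp add: L2_rel_def square_integrable_const)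

lift_definition plus_L2 :: "L2 \<Rightarrow> L2 \<Rightarrow> L2" is "\<lambda>f g x. f x + g x"
  by (auto simp: L2_rel_def square_integrable_add)

lift_definition uminus_L2 :: "L2 \<Rightarrow> L2" is "\<lambda>f x. - f x"
  by (auto simp: L2_rel_def square_integrable_uminus)

lift_definition minus_L2 :: "L2 \<Rightarrow> L2 \<Rightarrow> L2" is "\<lambda>f g x. f x - g x"
  using square_integrable_add[OF _ square_integrable_uminus] by (auto simp: L2_rel_def)

lift_definition scaleR_L2 :: "real \<Rightarrow> L2 \<Rightarrow> L2" is "\<lambda>r f x. complex_of_real r * f x"
  by (auto simp: L2_rel_def square_integrable_cmult)

text \<open>The real inner product is the real part of the complex one; both induce the
  same norm.\<close>

lift_definition inner_L2 :: "L2 \<Rightarrow> L2 \<Rightarrow> real" is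
  "\<lambda>f g. Re (\<integral>x. f x * cnj (g x) \<partial>unit_measure)"
proof -
  fix f f' g g' assume "L2_rel f f'" "L2_rel g g'"
  then have sq: "square_integrable f" "square_integrable f'" "square_integrable g" "square_integrable g'"
    and ae: "AE x in unit_measure. f x = f' x" "AE x in unit_measure. g x = g' x"
    by (auto simp: L2_rel_def)
  have "AE x in unit_measure. f x * cnj (g x) = f' x * cnj (g' x)"
    using ae by eventually_elim simp
  then show "Re (\<integral>x. f x * cnj (g x) \<partial>unit_measure) = Re (\<integral>x. f' x * cnj (g' x) \<partial>unit_measure)"
    using sq by (intro arg_cong[where f = Re] integral_cong_AE
        borel_measurable_integrable square_integrable_integrable_mult)
qed

lift_definition norm_L2 :: "L2 \<Rightarrow> real" is
  "\<lambda>f. sqrt (\<integral>x. (cmod (f x))\<^sup>2 \<partial>unit_measure)"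
proof -
  fix f g assume fg: "L2_rel f g"
  then have "AE x in unit_measure. f x = g x"
    by (simp add: L2_rel_def)
  then have "AE x in unit_measure. (cmod (f x))\<^sup>2 = (cmod (g x))\<^sup>2"
    by eventually_elim simp
  then show "sqrt (\<integral>x. (cmod (f x))\<^sup>2 \<partial>unit_measure) = sqrt (\<integral>x. (cmod (g x))\<^sup>2 \<partial>unit_measure)"
    using fg by (intro arg_cong[where f = sqrt] integral_cong_AE)
      (auto simp: L2_rel_def square_integrable_def)
qed

definition dist_L2 :: "L2 \<Rightarrow> L2 \<Rightarrow> real" where "dist_L2 f g = norm (f - g)"

definition sgn_L2 :: "L2 \<Rightarrow> L2" where "sgn_L2 f = inverse (norm f) *\<^sub>R f"

definition uniformity_L2 :: "(L2 \<times> L2) filter" where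
  "uniformity_L2 = (INF e\<in>{0<..}. principal {(x, y). dist x y < e})"

definition open_L2 :: "L2 set \<Rightarrow> bool" where
  "open_L2 U \<longleftrightarrow> (\<forall>x\<in>U. \<forall>\<^sub>F (x', y) in uniformity. x' = x \<longrightarrow> y \<in> U)"

lemma L2_inner_self:
  assumes "square_integrable f"
  shows "Re (\<integral>x. f x * cnj (f x) \<partial>unit_measure) = (\<integral>x. (cmod (f x))\<^sup>2 \<partial>unit_measure)"
  using integral_Re[OF square_integrable_integrable_mult[OF assms assms]]
  by (simp add: complex_mult_cnj cmod_def)

instance
proof
  fix x y z :: L2 and r s :: real and U :: "L2 set"
  show "x + y + z = x + (y + z)"
    by transfer (rule L2_rel_eqI, simp add: L2_rel_refl square_integrable_intros, simp add: algebra_simps)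
  show "x + y = y + x"
    by transfer (rule L2_rel_eqI, simp add: L2_rel_refl square_integrable_intros, simp add: algebra_simps)
  show "0 + x = x"
    by transfer (rule L2_rel_eqI, simp add: L2_rel_refl square_integrable_intros, simp add: algebra_simps)
  show "- x + x = 0"
    by transfer (rule L2_rel_eqI, simp add: L2_rel_refl square_integrable_intros, simp add: algebra_simps)
  show "x - y = x + - y"
    using square_integrable_add[OF _ square_integrable_uminus]
    by transfer (rule L2_rel_eqI; simp add: L2_rel_refl)
  show "r *\<^sub>R (x + y) = r *\<^sub>R x + r *\<^sub>R y"
    by transfer (rule L2_rel_eqI, simp add: L2_rel_refl square_integrable_intros, simp add: algebra_simps)
  show "(r + s) *\<^sub>R x = r *\<^sub>R x + s *\<^sub>R x"
    by transfer (rule L2_rel_eqI, simp add: L2_rel_refl square_integrable_intros, simp add: algebra_simps)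
  show "r *\<^sub>R s *\<^sub>R x = (r * s) *\<^sub>R x"
    by transfer (rule L2_rel_eqI, simp add: L2_rel_refl square_integrable_intros, simp add: algebra_simps)
  show "1 *\<^sub>R x = x"
    by transfer (rule L2_rel_eqI, simp add: L2_rel_refl square_integrable_intros, simp add: algebra_simps)
  show "dist x y = norm (x - y)" by (rule dist_L2_def)
  show "sgn x = inverse (norm x) *\<^sub>R x" by (rule sgn_L2_def)
  show "uniformity = (INF e\<in>{0<..}. principal {(x, y :: L2). dist x y < e})"
    by (rule uniformity_L2_def)
  show "open U \<longleftrightarrow> (\<forall>x\<in>U. \<forall>\<^sub>F (x', y) in uniformity. x' = x \<longrightarrow> y \<in> U)"
    by (rule open_L2_def)
  show "inner x y = inner y x"
  proof transfer
    fix f g assume fg: "L2_rel f f" "L2_rel g g"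
    have "(\<integral>x. g x * cnj (f x) \<partial>unit_measure) = (\<integral>x. cnj (f x * cnj (g x)) \<partial>unit_measure)"
      by (simp add: mult.commute del: Bochner_Integration.integral_cnj)
    also have "\<dots> = cnj (\<integral>x. f x * cnj (g x) \<partial>unit_measure)"
      by (rule Bochner_Integration.integral_cnj)
    finally show "Re (\<integral>x. f x * cnj (g x) \<partial>unit_measure) = Re (\<integral>x. g x * cnj (f x) \<partial>unit_measure)"
      by simp
  qed
  show "inner (x + y) z = inner x z + inner y z"
    by transfer
      (simp add: L2_rel_def distrib_right square_integrable_integrable_mult)
  show "inner (r *\<^sub>R x) y = r * inner x y"
    by transfer (simp add: mult.assoc)
  show "0 \<le> inner x x"
    by transfer (simp add: L2_rel_def L2_inner_self)
  show "inner x x = 0 \<longleftrightarrow> x = 0"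
  proof transfer
    fix f assume "L2_rel f f"
    then have f: "square_integrable f" by (simp add: L2_rel_def)
    have "(\<integral>x. (cmod (f x))\<^sup>2 \<partial>unit_measure) = 0 \<longleftrightarrow> (AE x in unit_measure. (cmod (f x))\<^sup>2 = 0)"
      using f by (intro integral_nonneg_eq_0_iff_AE) (auto simp: square_integrable_def)
    then show "Re (\<integral>x. f x * cnj (f x) \<partial>unit_measure) = 0 \<longleftrightarrow> L2_rel f (\<lambda>_. 0)"
      using f by (simp add: L2_inner_self L2_rel_def square_integrable_const)
  qed
  show "norm x = sqrt (inner x x)"
    by transfer (simp add: L2_rel_def L2_inner_self)
qed

end

instantiation L2 :: complex_normed_vector
begin

lift_definition scaleC_L2 :: "complex \<Rightarrow> L2 \<Rightarrow> L2" is "\<lambda>c f x. c * f x"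
  by (auto simp: L2_rel_def square_integrable_cmult)

instance
proof
  fix c d :: complex and r :: real and x y :: L2
  show "c *\<^sub>C (x + y) = c *\<^sub>C x + c *\<^sub>C y"
    by transfer (rule L2_rel_eqI, simp add: L2_rel_refl square_integrable_intros, simp add: algebra_simps)
  show "(c + d) *\<^sub>C x = c *\<^sub>C x + d *\<^sub>C x"
    by transfer (rule L2_rel_eqI, simp add: L2_rel_refl square_integrable_intros, simp add: algebra_simps)
  show "c *\<^sub>C (d *\<^sub>C x) = (c * d) *\<^sub>C x"
    by transfer (rule L2_rel_eqI, simp add: L2_rel_refl square_integrable_intros, simp add: algebra_simps)
  show "1 *\<^sub>C x = x"
    by transfer (rule L2_rel_eqI, simp add: L2_rel_refl square_integrable_intros, simp add: algebra_simps)
  show "r *\<^sub>R x = complex_of_real r *\<^sub>C x"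
    by transfer (rule L2_rel_eqI, simp add: L2_rel_refl square_integrable_intros, simp add: algebra_simps)
  show "norm (c *\<^sub>C x) = cmod c * norm x"
    by transfer (simp add: norm_mult power_mult_distrib real_sqrt_mult)
qed

end


section \<open>The operator\<close>

text \<open>Multiplication by a bounded measurable function. For other multipliers the value
  is the junk value 0.\<close>

lift_definition mult_L2 :: "(real \<Rightarrow> complex) \<Rightarrow> L2 \<Rightarrow> L2" is
  "\<lambda>h f x. if h \<in> borel_measurable unit_measure \<and> bounded (h ` {0<..<1}) then h x * f x else 0"
  subgoal for h f g
    by (cases "h \<in> borel_measurable unit_measure \<and> bounded (h ` {0<..<1})")
      (auto simp: L2_rel_def square_integrable_mult_bounded square_integrable_const
        simp del: mult_cancel_left)
  done

lift_definition integral_L2 :: "L2 \<Rightarrow> complex" is "\<lambda>f. \<integral>x. f x \<partial>unit_measure"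
  by (intro integral_cong_AE) (auto simp: L2_rel_def square_integrable_def)

lift_definition const_L2 :: "complex \<Rightarrow> L2" is "\<lambda>c _. c"
  by (simp add: L2_rel_def square_integrable_const)

definition A0 :: "real \<Rightarrow> (real \<Rightarrow> real) \<Rightarrow> (real \<Rightarrow> real) \<Rightarrow> L2 \<times> L2 \<Rightarrow> L2 \<times> L2" where
  "A0 g H u = (\<lambda>(\<phi>\<^sub>1, \<phi>\<^sub>2).
     (mult_L2 (\<lambda>x. complex_of_real (u x)) \<phi>\<^sub>1 + mult_L2 (\<lambda>x. complex_of_real (H x)) \<phi>\<^sub>2,
      const_L2 (complex_of_real g * integral_L2 \<phi>\<^sub>1) + mult_L2 (\<lambda>x. complex_of_real (u x)) \<phi>\<^sub>2))"

lemma bounded_clinear_mult_L2: "bounded_clinear (mult_L2 h)"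
proof (cases "h \<in> borel_measurable unit_measure \<and> bounded (h ` {0<..<1})")
  case True
  then obtain B where B: "\<And>x. x \<in> {0<..<1} \<Longrightarrow> cmod (h x) \<le> B"
    unfolding bounded_iff by blast
  have B0: "0 \<le> B" using order_trans[OF norm_ge_zero B[of "1/2"]] by simp
  have add: "mult_L2 h (x + y) = mult_L2 h x + mult_L2 h y" for x y
    using True by transfer (auto simp: L2_rel_def distrib_left
        intro!: square_integrable_add square_integrable_mult_bounded)
  have scale: "mult_L2 h (c *\<^sub>C x) = c *\<^sub>C mult_L2 h x" for c x
    using True by transfer (auto simp: L2_rel_def mult.left_commute
        intro!: square_integrable_cmult square_integrable_mult_bounded)
  have norm: "norm (mult_L2 h x) \<le> norm x * B" for x
    using True
  proof (transfer fixing: h B)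
    fix f
    assume "L2_rel f f" and h: "h \<in> borel_measurable unit_measure \<and> bounded (h ` {0<..<1})"
    then have f: "square_integrable f" by (simp add: L2_rel_def)
    have "(\<integral>x. (cmod (h x * f x))\<^sup>2 \<partial>unit_measure) \<le> (\<integral>x. B\<^sup>2 * (cmod (f x))\<^sup>2 \<partial>unit_measure)"
    proof (rule integral_mono)
      show "integrable unit_measure (\<lambda>x. (cmod (h x * f x))\<^sup>2)"
        using square_integrable_mult_bounded[of h f] h f by (simp add: square_integrable_def)
      show "integrable unit_measure (\<lambda>x. B\<^sup>2 * (cmod (f x))\<^sup>2)"
        using f by (simp add: square_integrable_def)
      fix x assume "x \<in> space unit_measure"
      then have "(cmod (h x))\<^sup>2 \<le> B\<^sup>2" using B by (intro power_mono) auto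
      then show "(cmod (h x * f x))\<^sup>2 \<le> B\<^sup>2 * (cmod (f x))\<^sup>2"
        by (simp add: norm_mult power_mult_distrib mult_right_mono)
    qed
    then have "sqrt (\<integral>x. (cmod (h x * f x))\<^sup>2 \<partial>unit_measure)
        \<le> sqrt (B\<^sup>2 * (\<integral>x. (cmod (f x))\<^sup>2 \<partial>unit_measure))"
      by simp
    also have "\<dots> = sqrt (\<integral>x. (cmod (f x))\<^sup>2 \<partial>unit_measure) * B"
      using B0 by (simp add: real_sqrt_mult)
    finally show "sqrt (\<integral>x. (cmod (if h \<in> borel_measurable unit_measure \<and> bounded (h ` {0<..<1})
        then h x * f x else 0))\<^sup>2 \<partial>unit_measure) \<le> sqrt (\<integral>x. (cmod (f x))\<^sup>2 \<partial>unit_measure) * B"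
      using h by simp
  qed
  show ?thesis
    unfolding bounded_clinear_def
    by (auto intro!: bounded_linear_intro[where K = B] simp: add norm scaleR_scaleC scale)
next
  case False
  have "mult_L2 h x = 0" for x
    by (transfer fixing: h) (unfold if_not_P[OF False], simp add: L2_rel_refl square_integrable_const)
  then have "mult_L2 h = (\<lambda>_. 0)" by auto
  moreover have "c *\<^sub>C (0::L2) = 0" for c
    using norm_scaleC[of c "0::L2"] by simp
  ultimately show ?thesis by (simp add: bounded_clinear_def)
qed

lemma norm_const_L2: "norm (const_L2 c) = cmod c"
proof -
  have "measure unit_measure (space unit_measure) = 1"
    by (simp add: measure_restrict_space)
  then show ?thesis
    by transfer simp
qed

lemma integral_L2_bound: "cmod (integral_L2 x) \<le> norm x"
proof -
  define c where "c = integral_L2 x"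
  have "inner x (const_L2 c) = (cmod c)\<^sup>2"
    unfolding c_def
    by transfer (simp add: L2_rel_def square_integrable_integrable complex_mult_cnj cmod_def)
  then have "(cmod c)\<^sup>2 \<le> norm x * cmod c"
    using norm_cauchy_schwarz[of x "const_L2 c"] by (simp add: norm_const_L2)
  then show ?thesis
    unfolding c_def[symmetric] by (cases "c = 0") (auto simp: power2_eq_square)
qed

lemma bounded_clinear_const_integral_L2:
  "bounded_clinear (\<lambda>x. const_L2 (d * integral_L2 x))"
proof -
  have int_add: "integral_L2 (x + y) = integral_L2 x + integral_L2 y" for x y
    by transfer (simp add: L2_rel_def square_integrable_integrable)
  have int_scale: "integral_L2 (c *\<^sub>C x) = c * integral_L2 x" for c x
    by transfer simp
  have c_add: "const_L2 (c + c') = const_L2 c + const_L2 c'" for c c'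
    by transfer (simp add: L2_rel_def square_integrable_const)
  have c_scale: "const_L2 (c * c') = c *\<^sub>C const_L2 c'" for c c'
    by transfer (simp add: L2_rel_def square_integrable_const)
  have scale: "const_L2 (d * integral_L2 (c *\<^sub>C x)) = c *\<^sub>C const_L2 (d * integral_L2 x)" for c x
    by (simp add: int_scale mult.left_commute flip: c_scale)
  show ?thesis
    unfolding bounded_clinear_def
    by (auto intro!: bounded_linear_intro[where K = "cmod d"] mult_left_mono integral_L2_bound
        simp: int_add c_add distrib_left scale scaleR_scaleC norm_const_L2 norm_mult
          mult.commute[of "norm _" "cmod d"])
qed

lemma bounded_clinear_A0: "bounded_clinear (A0 g H u)"
proof -
  have *: "A0 g H u = (\<lambda>p.
     (mult_L2 (\<lambda>x. complex_of_real (u x)) (fst p) + mult_L2 (\<lambda>x. complex_of_real (H x)) (snd p),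
      const_L2 (complex_of_real g * integral_L2 (fst p))
        + mult_L2 (\<lambda>x. complex_of_real (u x)) (snd p)))"
    by (auto simp: A0_def)
  note m = bounded_clinear_mult_L2[unfolded bounded_clinear_def]
  note k = bounded_clinear_const_integral_L2[unfolded bounded_clinear_def]
  have "bounded_linear (A0 g H u)"
    unfolding *
    by (intro bounded_linear_Pair bounded_linear_add
        bounded_linear_compose[OF conjunct1[OF m]] bounded_linear_compose[OF conjunct1[OF k]]
        bounded_linear_fst bounded_linear_snd)
  moreover have "A0 g H u (c *\<^sub>C p) = c *\<^sub>C A0 g H u p" for c p
    unfolding * using m k by (simp add: scaleC_prod_def scaleC_add_right)
  ultimately show ?thesis by (simp add: bounded_clinear_def)
qed

end

theory Submission
  imports Defs
begin

text \<open>
  For a non-real number \<open>c\<close> with \<open>\<integral> 1 / (u - c)\<^sup>2 = 1\<close> the pair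
  \<open>(1 / (u - c)\<^sup>2, - g / (u - c))\<close> is an eigenvector of \<open>A0\<close> for the eigenvalue \<open>c\<close>.
  Put \<open>c = i a k\<close> with \<open>k > 0\<close>. For the tanh profile the imaginary part of the
  integral vanishes by the symmetry \<open>x \<mapsto> 1 - x\<close>, and the real part has an elementary
  antiderivative, so the condition becomes \<open>D k = a\<^sup>2\<close> for an explicit function \<open>D\<close>.
  It extends continuously to \<open>k = 0\<close> with value \<open>1 - 1 / (b tanh b) > a\<^sup>2\<close>, and
  \<open>D 1 \<le> 0\<close>, so a root exists by the intermediate value theorem.
\<close>

text \<open>A linear left inverse of \<open>T - c\<close> would send
  \<open>T v - c *\<^sub>C v = 0\<close> both to 0 and to the eigenvector \<open>v\<close>.\<close>

lemma eigenvalue_in_spectrum: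
  assumes "eigenvalue T c"
  shows "c \<in> spectrum T"
proof -
  obtain v where v: "v \<noteq> 0" "T v = c *\<^sub>C v" using assms by (auto simp: eigenvalue_def)
  have "\<not> (bounded_clinear S \<and> (\<forall>v. S (T v - c *\<^sub>C v) = v) \<and> (\<forall>v. T (S v) - c *\<^sub>C S v = v))" for S
    using v by (metis bounded_clinear_def cancel_comm_monoid_add_class.diff_cancel linear_simps(3))
  then show ?thesis by (simp add: spectrum_def)
qed

text \<open>The summand \<open>pi / 2 - arctan (k / tanh b)\<close> is \<open>arctan (tanh b / k)\<close> for \<open>k > 0\<close>,
  written so that it is also continuous at \<open>k = 0\<close>.\<close>

definition dispersion :: "real \<Rightarrow> real \<Rightarrow> real" where
  "dispersion b k = (1 - k\<^sup>2) / (1 + k\<^sup>2)\<^sup>2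
     - (tanh b / ((1 + k\<^sup>2) * ((tanh b)\<^sup>2 + k\<^sup>2)) + 2 * k / (1 + k\<^sup>2)\<^sup>2 * (pi / 2 - arctan (k / tanh b))) / b"

lemma dispersion_root:
  assumes b: "b > 0" and y: "y > 0" "y < 1 - inverse (b * tanh b)"
  shows "\<exists>k>0. dispersion b k = y"
proof -
  have t: "tanh b > 0" using b by simp
  have "\<exists>k\<ge>0. k \<le> 1 \<and> dispersion b k = y"
  proof (rule IVT2)
    \<comment> \<open>At 1 the term with \<open>1 - k\<^sup>2\<close> vanishes, and only the
      subtracted nonnegative bracket remains.\<close>
    have "arctan (1 / tanh b) < pi / 2" by (rule arctan_ubound)
    then have "0 \<le> tanh b / (2 * ((tanh b)\<^sup>2 + 1)) + 2 / 4 * (pi / 2 - arctan (1 / tanh b))"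
      using t by (intro add_nonneg_nonneg mult_nonneg_nonneg divide_nonneg_nonneg) auto
    then have "dispersion b 1 \<le> 0" using b
      by (simp add: dispersion_def)
    then show "dispersion b 1 \<le> y" using y by simp
    show "y \<le> dispersion b 0" using y b t
      by (simp add: dispersion_def power2_eq_square field_simps)
    show "\<forall>x. 0 \<le> x \<and> x \<le> 1 \<longrightarrow> isCont (dispersion b) x"
    proof (intro allI impI)
      fix x :: real
      have "(1 + x\<^sup>2) \<noteq> 0" "(tanh b)\<^sup>2 + x\<^sup>2 \<noteq> 0" using t
        by (auto simp: add_nonneg_eq_0_iff sum_power2_eq_zero_iff intro: add_pos_nonneg less_imp_neq[symmetric])
      then show "isCont (dispersion b) x"
        unfolding dispersion_def using b t by (intro continuous_intros) auto
    qed
  qed simp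
  then obtain k where k: "k \<ge> 0" "dispersion b k = y" by auto
  \<comment> \<open>Strictness of the upper bound on \<open>y\<close> excludes the root 0, which
    would give a real eigenvalue.\<close>
  have "dispersion b 0 = 1 - inverse (b * tanh b)" using b t
    by (simp add: dispersion_def power2_eq_square field_simps)
  then have "k \<noteq> 0" using k y by auto
  then show ?thesis using k by (intro exI[of _ k]) auto
qed

text \<open>The formula for \<open>A\<close> comes from substituting t = tanh y, dy = dt / (1 -
  t^2), and from partial fractions in t^2 with the denominators 1 - t^2, t^2 + k^2 and (t^2 +
  k^2)^2. The first of these integrates to artanh t = y, which gives the linear term.\<close>

lemma tanh_antiderivative:
  fixes k :: real
  assumes k: "k > 0"
  defines "A \<equiv> \<lambda>y. (1 - k\<^sup>2) / (1 + k\<^sup>2)\<^sup>2 * y - tanh y / ((1 + k\<^sup>2) * ((tanh y)\<^sup>2 + k\<^sup>2))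
      - 2 * k / (1 + k\<^sup>2)\<^sup>2 * arctan (tanh y / k)"
  shows "(A has_real_derivative ((tanh y)\<^sup>2 - k\<^sup>2) / ((tanh y)\<^sup>2 + k\<^sup>2)\<^sup>2) (at y)"
proof -
  define t where "t = tanh y"
  have p: "1 + k\<^sup>2 > 0" "t\<^sup>2 + k\<^sup>2 > 0" "1 + (t / k)\<^sup>2 > 0" using k by (auto intro: add_pos_nonneg add_nonneg_pos)
  have 1: "inverse (1 + (t / k)\<^sup>2) = k\<^sup>2 / (t\<^sup>2 + k\<^sup>2)"
    using k p by (simp add: field_simps)
  have "(A has_real_derivative (1 - k\<^sup>2) / (1 + k\<^sup>2)\<^sup>2
     - ((1 - t\<^sup>2) * ((1 + k\<^sup>2) * (t\<^sup>2 + k\<^sup>2)) - t * ((1 + k\<^sup>2) * (2 * t * (1 - t\<^sup>2)))) / ((1 + k\<^sup>2) * (t\<^sup>2 + k\<^sup>2))\<^sup>2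
     - 2 * k / (1 + k\<^sup>2)\<^sup>2 * (k\<^sup>2 / (t\<^sup>2 + k\<^sup>2) * ((1 - t\<^sup>2) / k))) (at y)"
  proof -
    have T: "(tanh has_real_derivative 1 - t\<^sup>2) (at y)"
      unfolding t_def by (auto intro!: derivative_eq_intros)
    have "((\<lambda>y. tanh y / (P * ((tanh y)\<^sup>2 + k\<^sup>2))) has_real_derivative
        ((1 - t\<^sup>2) * (P * (t\<^sup>2 + k\<^sup>2)) - t * (P * (2 * t * (1 - t\<^sup>2)))) / (P * (t\<^sup>2 + k\<^sup>2))\<^sup>2) (at y)"
      if "P \<noteq> 0" for P
      using that p T unfolding t_def
      by (auto intro!: derivative_eq_intros simp: power2_eq_square)
    moreover have "((\<lambda>y. arctan (tanh y / k)) has_real_derivative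
        k\<^sup>2 / (t\<^sup>2 + k\<^sup>2) * ((1 - t\<^sup>2) / k)) (at y)"
      unfolding 1[symmetric] using DERIV_chain2[OF DERIV_arctan DERIV_cdivide[OF T, of k]]
      by (simp add: t_def)
    ultimately show ?thesis
      unfolding A_def using p
      by (intro DERIV_diff DERIV_cmult DERIV_cmult_Id) auto
  qed
  also have "(1 - k\<^sup>2) / (1 + k\<^sup>2)\<^sup>2
     - ((1 - t\<^sup>2) * ((1 + k\<^sup>2) * (t\<^sup>2 + k\<^sup>2)) - t * ((1 + k\<^sup>2) * (2 * t * (1 - t\<^sup>2)))) / ((1 + k\<^sup>2) * (t\<^sup>2 + k\<^sup>2))\<^sup>2
     - 2 * k / (1 + k\<^sup>2)\<^sup>2 * (k\<^sup>2 / (t\<^sup>2 + k\<^sup>2) * ((1 - t\<^sup>2) / k)) = (t\<^sup>2 - k\<^sup>2) / (t\<^sup>2 + k\<^sup>2)\<^sup>2"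
  proof -
    \<comment> \<open>Keeping both factors opaque while the fractions are cleared leaves a
      polynomial identity in t and k, which is then expanded.\<close>
    define P Q where "P = 1 + k\<^sup>2" and "Q = t\<^sup>2 + k\<^sup>2"
    have PQ: "P > 0" "Q > 0" using p by (auto simp: P_def Q_def)
    have "(1 - k\<^sup>2) / P\<^sup>2 - ((1 - t\<^sup>2) * (P * Q) - t * (P * (2 * t * (1 - t\<^sup>2)))) / (P * Q)\<^sup>2
       - 2 * k / P\<^sup>2 * (k\<^sup>2 / Q * ((1 - t\<^sup>2) / k)) =
       ((1 - k\<^sup>2) * Q\<^sup>2 - (1 - t\<^sup>2) * P * (Q - 2 * t\<^sup>2) - 2 * k\<^sup>2 * Q * (1 - t\<^sup>2)) / (P\<^sup>2 * Q\<^sup>2)"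
      using PQ k by (simp add: field_simps power2_eq_square)
    also have "(1 - k\<^sup>2) * Q\<^sup>2 - (1 - t\<^sup>2) * P * (Q - 2 * t\<^sup>2) - 2 * k\<^sup>2 * Q * (1 - t\<^sup>2) = P\<^sup>2 * (t\<^sup>2 - k\<^sup>2)"
      unfolding P_def Q_def by algebra
    finally show ?thesis using PQ unfolding P_def Q_def by simp
  qed
  finally show ?thesis by (simp add: t_def)
qed

text \<open>Substituting y = b (2 x - 1) reduces this to the antiderivative \<open>A\<close> between
  -b and b, with a factor 1 / (2 b). Since \<open>A\<close> is odd, the value is A(b) / b.\<close>

lemma dispersion_integral:
  fixes b k :: real
  assumes b: "b > 0" and k: "k > 0"
  defines "T \<equiv> \<lambda>x. tanh (b * (2 * x - 1))"
  shows "((\<lambda>x. ((T x)\<^sup>2 - k\<^sup>2) / ((T x)\<^sup>2 + k\<^sup>2)\<^sup>2) has_integral dispersion b k) {0..1}"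
proof -
  define A where "A = (\<lambda>y. (1 - k\<^sup>2) / (1 + k\<^sup>2)\<^sup>2 * y - tanh y / ((1 + k\<^sup>2) * ((tanh y)\<^sup>2 + k\<^sup>2))
      - 2 * k / (1 + k\<^sup>2)\<^sup>2 * arctan (tanh y / k))"
  have d: "((\<lambda>x. A (b * (2 * x - 1)) / (2 * b)) has_real_derivative ((T x)\<^sup>2 - k\<^sup>2) / ((T x)\<^sup>2 + k\<^sup>2)\<^sup>2) (at x)" for x
  proof -
    have "((\<lambda>x. b * (2 * x - 1)) has_real_derivative 2 * b) (at x)"
      by (auto intro!: derivative_eq_intros)
    from DERIV_cdivide[OF DERIV_chain2[OF tanh_antiderivative[OF k] this], of "2 * b"]
    show ?thesis unfolding T_def A_def using b by simp
  qed
  have t: "tanh b > 0" using b by simp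
  have "arctan (tanh b / k) = pi / 2 - arctan (k / tanh b)"
    using arctan_inverse[of "tanh b / k"] t k by simp
  then have "A b / b = dispersion b k"
    using b by (simp add: A_def dispersion_def diff_divide_distrib add_divide_distrib)
  moreover have "A (- b) = - A b"
    by (simp add: A_def arctan_minus)
  ultimately have "A (b * (2 * 1 - 1)) / (2 * b) - A (b * (2 * 0 - 1)) / (2 * b) = dispersion b k"
    by simp
  then show ?thesis
    using fundamental_theorem_of_calculus[of 0 1 "\<lambda>x. A (b * (2 * x - 1)) / (2 * b)"] d
    by (metis (no_types, lifting) has_real_derivative_iff_has_vector_derivative has_vector_derivative_at_within zero_le_one)
qed

text \<open>The integrand is odd about 1/2, so the reflection x to 1 - x shows that its integral
  equals its own negative.\<close>

lemma tanh_odd_integral: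
  fixes b k :: real
  assumes k: "k > 0"
  defines "T \<equiv> \<lambda>x. tanh (b * (2 * x - 1))"
  shows "((\<lambda>x. 2 * k * T x / ((T x)\<^sup>2 + k\<^sup>2)\<^sup>2) has_integral 0) {0..1}"
proof -
  define f where "f = (\<lambda>x. 2 * k * T x / ((T x)\<^sup>2 + k\<^sup>2)\<^sup>2)"
  have nz: "(T x)\<^sup>2 + k\<^sup>2 \<noteq> 0" for x using k by (simp add: add_nonneg_eq_0_iff)
  have "f integrable_on {0..1}"
    unfolding f_def using nz by (intro integrable_continuous_real continuous_intros) (auto simp: T_def intro!: continuous_intros)
  then have I: "(f has_integral integral {0..1} f) {0..1}" by blast
  have "((\<lambda>x. f (- x + 1)) has_integral integral {0..1} f) {0..1}"
    using has_integral_affinity[OF I[folded box_real], of "-1" 1] by (simp add: image_affinity_atLeastAtMost)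
  moreover have "f (- x + 1) = - f x" for x
  proof -
    have "T (- x + 1) = - T x" unfolding T_def
      by (subst tanh_minus[symmetric]) (simp add: algebra_simps)
    then show ?thesis by (simp add: f_def)
  qed
  ultimately have "((\<lambda>x. - f x) has_integral integral {0..1} f) {0..1}" by simp
  with has_integral_neg[OF I] have "integral {0..1} f = - integral {0..1} f" by (metis has_integral_unique)
  with I show ?thesis unfolding f_def by simp
qed

text \<open>The coefficients of the operator are prescribed on the open interval only. Boundedness
  comes from a continuous function \<open>h'\<close> on the compact closed interval that agrees with
  \<open>h\<close> inside.\<close>

lemma continuous_Icc_multiplier:
  fixes h h' :: "real \<Rightarrow> complex"
  assumes "continuous_on {0..1} h'" "\<And>x. x \<in> {0<..<1} \<Longrightarrow> h x = h' x"
  shows "h \<in> borel_measurable unit_measure \<and> bounded (h ` {0<..<1})"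
proof
  have "continuous_on {0<..<1} h'"
    by (rule continuous_on_subset[OF assms(1)]) auto
  then have "continuous_on {0<..<1} h"
    using assms(2) continuous_on_cong[of "{0<..<1}" "{0<..<1}" h h'] by simp
  then show "h \<in> borel_measurable unit_measure"
    by (rule continuous_imp_measurable_on_sets_lebesgue) simp
  have "bounded (h' ` {0..1})"
    using assms(1) by (intro compact_imp_bounded compact_continuous_image) auto
  then show "bounded (h ` {0<..<1})"
    by (rule bounded_subset) (use assms(2) in force)
qed

lemma continuous_Icc_square_integrable:
  assumes "continuous_on {0..1} h" shows "square_integrable h"
  using square_integrable_mult_bounded[of h "\<lambda>_. 1"] continuous_Icc_multiplier[OF assms, of h]
    square_integrable_const by simp

text \<open>As H = 1/g, the first row of the eigenvalue equation forces f2 = - g (u - c) f1. The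
  second row then says that (u - c)^2 f1 is the constant \<integral> f1, and \<open>I\<close> is
  exactly the consistency condition for normalising this constant to 1.\<close>

lemma eigenvalue_A0:
  assumes g: "g \<noteq> 0" and H: "\<And>x. x \<in> {0<..<1} \<Longrightarrow> H x = inverse g"
    and u: "\<And>x. x \<in> {0<..<1} \<Longrightarrow> u x = v x" and v: "continuous_on {0..1} v"
    and c: "Im c \<noteq> 0" and I: "(\<integral>x. 1 / (complex_of_real (v x) - c)\<^sup>2 \<partial>unit_measure) = 1"
  shows "eigenvalue (A0 g H u) c"
proof -
  have nz: "complex_of_real r - c \<noteq> 0" for r using c by (auto simp: complex_eq_iff)
  define f1 f2 where "f1 = (\<lambda>x. 1 / (complex_of_real (v x) - c)\<^sup>2)"
    and "f2 = (\<lambda>x. - of_real g / (complex_of_real (v x) - c))"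
  have s: "square_integrable f1" "square_integrable f2"
    unfolding f1_def f2_def using nz v by (auto intro!: continuous_Icc_square_integrable continuous_intros)
  then have r: "L2_rel f1 f1" "L2_rel f2 f2" by (auto simp: L2_rel_refl)
  \<comment> \<open>Without these two facts \<open>mult_L2\<close> would return its default value 0
    instead of the product.\<close>
  have bu: "(\<lambda>x. complex_of_real (u x)) \<in> borel_measurable unit_measure \<and> bounded ((\<lambda>x. complex_of_real (u x)) ` {0<..<1})"
    using continuous_Icc_multiplier[of "\<lambda>x. of_real (v x)"] u v by (auto intro: continuous_intros)
  have bH: "(\<lambda>x. complex_of_real (H x)) \<in> borel_measurable unit_measure \<and> bounded ((\<lambda>x. complex_of_real (H x)) ` {0<..<1})"
    using continuous_Icc_multiplier[of "\<lambda>x. of_real (inverse g)"] H by auto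
  have e: "abs_L2 p = abs_L2 q" if "square_integrable p" "square_integrable q" "\<And>x. x \<in> {0<..<1} \<Longrightarrow> p x = q x" for p q
  proof -
    have "L2_rel p q" using that by (auto simp: L2_rel_def intro!: AE_I2)
    then show ?thesis using Quotient3_L2 by (metis Quotient3_rel)
  qed
  have m: "square_integrable (\<lambda>x. of_real (u x) * f1 x)" "square_integrable (\<lambda>x. of_real (u x) * f2 x)"
     "square_integrable (\<lambda>x. of_real (H x) * f2 x)"
    using bu bH s by (auto intro!: square_integrable_mult_bounded)
  define w where "w = (abs_L2 f1, abs_L2 f2)"
  have "A0 g H u w = c *\<^sub>C w"
  proof -
    have "mult_L2 (\<lambda>x. complex_of_real (u x)) (abs_L2 f1) + mult_L2 (\<lambda>x. complex_of_real (H x)) (abs_L2 f2)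
       = abs_L2 (\<lambda>x. of_real (u x) * f1 x + of_real (H x) * f2 x)"
      using bu bH m r by (simp add: mult_L2.abs_eq plus_L2.abs_eq L2_rel_refl)
    also have "\<dots> = abs_L2 (\<lambda>x. c * f1 x)"
    proof (rule e)
      fix x :: real assume x: "x \<in> {0<..<1}"
      show "of_real (u x) * f1 x + of_real (H x) * f2 x = c * f1 x"
        using nz[of "v x"] g unfolding u[OF x] H[OF x] f1_def f2_def
        by (simp add: divide_simps) (simp add: algebra_simps power2_eq_square)
    qed (use m s in \<open>auto intro!: square_integrable_intros\<close>)
    finally have 1: "mult_L2 (\<lambda>x. complex_of_real (u x)) (abs_L2 f1) + mult_L2 (\<lambda>x. complex_of_real (H x)) (abs_L2 f2)
       = c *\<^sub>C abs_L2 f1" using r by (simp add: scaleC_L2.abs_eq)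
    have "integral_L2 (abs_L2 f1) = 1" using r I by (simp add: integral_L2.abs_eq f1_def)
    then have "const_L2 (complex_of_real g * integral_L2 (abs_L2 f1)) + mult_L2 (\<lambda>x. complex_of_real (u x)) (abs_L2 f2)
       = abs_L2 (\<lambda>x. of_real g + of_real (u x) * f2 x)"
      using bu bH m r by (simp add: mult_L2.abs_eq plus_L2.abs_eq L2_rel_refl const_L2_def square_integrable_const)
    also have "\<dots> = abs_L2 (\<lambda>x. c * f2 x)"
    proof (rule e)
      fix x :: real assume x: "x \<in> {0<..<1}"
      show "of_real g + of_real (u x) * f2 x = c * f2 x"
        using nz[of "v x"] g unfolding u[OF x] f2_def
        by (simp add: divide_simps) (simp add: algebra_simps)
    qed (use m s in \<open>auto intro!: square_integrable_intros\<close>)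
    finally have 2: "const_L2 (complex_of_real g * integral_L2 (abs_L2 f1)) + mult_L2 (\<lambda>x. complex_of_real (u x)) (abs_L2 f2)
       = c *\<^sub>C abs_L2 f2" using r by (simp add: scaleC_L2.abs_eq)
    show ?thesis unfolding w_def A0_def scaleC_prod_def using 1 2 by simp
  qed
  \<comment> \<open>The first component has integral 1, so its class is not zero.\<close>
  moreover have "w \<noteq> 0"
  proof
    assume "w = 0"
    then have "abs_L2 f1 = 0" by (simp add: w_def zero_prod_def)
    then have "integral_L2 (abs_L2 f1) = integral_L2 0" by simp
    then have "(1::complex) = 0" using r I by (simp add: integral_L2.abs_eq f1_def zero_L2_def L2_rel_refl square_integrable_const)
    then show False by simp
  qed
  ultimately show ?thesis unfolding eigenvalue_def by blast
qed

text \<open>With the spectral parameter scaled by \<open>a\<close>, the factor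
  \<open>a\<^sup>2\<close> leaves the denominator; the real part then integrates to
  \<open>dispersion b k\<close> and the imaginary part to 0.\<close>

lemma tanh_dispersion_integral:
  fixes a b k :: real
  assumes "a \<noteq> 0" "b > 0" "k > 0"
  shows "(\<integral>x. 1 / (complex_of_real (a * tanh (b * (2 * x - 1))) - \<i> * of_real (a * k))\<^sup>2 \<partial>unit_measure)
    = of_real (dispersion b k / a\<^sup>2)"
proof -
  define T where "T = (\<lambda>x. tanh (b * (2 * x - 1)))"
  define F where "F = (\<lambda>x. 1 / (complex_of_real (a * T x) - \<i> * of_real (a * k))\<^sup>2)"
  have nz: "complex_of_real (a * T x) - \<i> * of_real (a * k) \<noteq> 0" for x
    using assms by (auto simp: complex_eq_iff)
  \<comment> \<open>Expanding 1 / (T - i k) to (T + i k) / (T^2 + k^2) before squaring separates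
    real and imaginary parts.\<close>
  have F: "F x = of_real (((T x)\<^sup>2 - k\<^sup>2) / ((T x)\<^sup>2 + k\<^sup>2)\<^sup>2 / a\<^sup>2)
     + \<i> * of_real (2 * k * T x / ((T x)\<^sup>2 + k\<^sup>2)\<^sup>2 / a\<^sup>2)" for x
  proof -
    define t where "t = complex_of_real (T x)"
    have "(T x)\<^sup>2 + k\<^sup>2 \<noteq> 0" using assms by (simp add: add_nonneg_eq_0_iff)
    then have "complex_of_real ((T x)\<^sup>2 + k\<^sup>2) \<noteq> 0" by (simp only: of_real_eq_0_iff not_False_eq_True)
    then have "t\<^sup>2 + (of_real k)\<^sup>2 \<noteq> 0" by (simp add: t_def)
    moreover have fact: "(t - \<i> * of_real k) * (t + \<i> * of_real k) = t\<^sup>2 + (of_real k)\<^sup>2"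
      by (simp add: algebra_simps power2_eq_square)
    ultimately have n: "t - \<i> * of_real k \<noteq> 0" "t + \<i> * of_real k \<noteq> 0" by auto
    have "F x = 1 / ((of_real a)\<^sup>2 * (t - \<i> * of_real k)\<^sup>2)"
      unfolding F_def t_def by (simp add: power2_eq_square algebra_simps)
    also have "\<dots> = (t + \<i> * of_real k)\<^sup>2 / (t\<^sup>2 + (of_real k)\<^sup>2)\<^sup>2 / (of_real a)\<^sup>2"
      using n assms unfolding fact[symmetric] by (simp add: power_mult_distrib divide_simps)
    also have "(t + \<i> * of_real k)\<^sup>2 = t\<^sup>2 - (of_real k)\<^sup>2 + \<i> * (2 * of_real k * t)"
      by (simp add: algebra_simps power2_eq_square)
    finally show ?thesis by (simp add: t_def add_divide_distrib)
  qed
  have cont: "continuous_on S F" for S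
    unfolding F_def using nz by (auto simp: T_def intro!: continuous_intros)
  have R: "((\<lambda>x. complex_of_real (((T x)\<^sup>2 - k\<^sup>2) / ((T x)\<^sup>2 + k\<^sup>2)\<^sup>2 / a\<^sup>2)) has_integral of_real (dispersion b k / a\<^sup>2)) {0..1}"
    unfolding T_def by (intro has_integral_of_real has_integral_divide dispersion_integral assms)
  have I: "((\<lambda>x. \<i> * complex_of_real (2 * k * T x / ((T x)\<^sup>2 + k\<^sup>2)\<^sup>2 / a\<^sup>2)) has_integral \<i> * of_real (0 / a\<^sup>2)) {0..1}"
    unfolding T_def by (intro has_integral_mult_right has_integral_of_real has_integral_divide tanh_odd_integral assms)
  have "(F has_integral of_real (dispersion b k / a\<^sup>2)) {0..1}"
    using has_integral_add[OF R I] unfolding F by simp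
  \<comment> \<open>Dropping the endpoints and using Lebesgue integrability carries the gauge
    integral over to \<open>unit_measure\<close>.\<close>
  then have "(F has_integral of_real (dispersion b k / a\<^sup>2)) {0<..<1}"
    by (simp add: has_integral_Icc_iff_Ioo)
  moreover have "integrable unit_measure F"
    by (intro square_integrable_integrable continuous_Icc_square_integrable cont)
  ultimately have "integral\<^sup>L unit_measure F = of_real (dispersion b k / a\<^sup>2)"
    by (simp add: lebesgue_integral_eq_integral integral_unique)
  then show ?thesis by (simp add: F_def T_def)
qed

theorem proposition4p11:
  fixes g a b :: real and H u :: "real \<Rightarrow> real"
  assumes "g > 0" and "a \<noteq> 0" and "b > 0"
    and "b * tanh b > 1"
    and "\<bar>a\<bar> < sqrt (1 - inverse (b * tanh b))"
    and "\<And>x. x \<in> {0<..<1} \<Longrightarrow> H x = inverse g"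
    and "\<And>x. x \<in> {0<..<1} \<Longrightarrow> u x = a * tanh (b * (2 * x - 1))"
  shows "\<exists>c. Re c = 0 \<and> Im c \<noteq> 0 \<and>
    {c, cnj c} \<subseteq> spectrum (A0 g H u) \<and>
    eigenvalue (A0 g H u) c \<and> eigenvalue (A0 g H u) (cnj c)"
proof -
  have "a\<^sup>2 < 1 - inverse (b * tanh b)"
    using assms(5) by (metis abs_ge_zero power2_abs real_less_rsqrt real_sqrt_less_iff real_sqrt_abs)
  \<comment> \<open>The target value \<open>a\<^sup>2\<close> is the one for which the integral
    \<open>dispersion b k / a\<^sup>2\<close> equals 1.\<close>
  then obtain k where k: "k > 0" "dispersion b k = a\<^sup>2"
    using dispersion_root[of b "a\<^sup>2"] assms by auto
  define c where "c = \<i> * complex_of_real (a * k)"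
  define v where "v = (\<lambda>x. a * tanh (b * (2 * x - 1)))"
  have I: "(\<integral>x. 1 / (complex_of_real (v x) - c)\<^sup>2 \<partial>unit_measure) = 1"
    using tanh_dispersion_integral[of a b k] assms k by (simp add: v_def c_def)
  \<comment> \<open>As \<open>v\<close> is real, replacing \<open>c\<close> by its conjugate
    conjugates the integrand, and the integral 1 is its own conjugate.\<close>
  have "(\<integral>x. 1 / (complex_of_real (v x) - cnj c)\<^sup>2 \<partial>unit_measure) =
     (\<integral>x. cnj (1 / (complex_of_real (v x) - c)\<^sup>2) \<partial>unit_measure)"
    by (simp del: Bochner_Integration.integral_cnj)
  also have "\<dots> = 1" by (subst Bochner_Integration.integral_cnj) (simp add: I)
  finally have J: "(\<integral>x. 1 / (complex_of_real (v x) - cnj c)\<^sup>2 \<partial>unit_measure) = 1" .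
  have v: "continuous_on {0..1} v" unfolding v_def by (auto intro!: continuous_intros)
  have c: "Re c = 0" "Im c \<noteq> 0" using assms k by (auto simp: c_def)
  have "eigenvalue (A0 g H u) c" "eigenvalue (A0 g H u) (cnj c)"
    using eigenvalue_A0[of g H u v] assms(1,6,7) v c I J by (auto simp: v_def)
  with c eigenvalue_in_spectrum show ?thesis by blast
qed
end
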